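(* Let $d\ge 2$, $\alpha>0$, and let $\mathsf Q$ be a probability measure on $\mathbb{R}_+$; let $\rho$ denote a random variable with distribution $\mathsf Q$. Consider the Boolean model in $\mathbb{R}^d$ with intensity $\alpha$ and radii distribution $\mathsf Q$. If $\mathsf E[\rho^d]<\infty$, then $$\lim_{r\to\infty}\frac1r\log P_{\mathrm{vis}}(r)=\lim_{r\to\infty}\frac1r\log f(r)=-\alpha\,\kappa_{d-1}\,\mathsf E[\rho^{d-1}].$$
   Context: $\kappa_s$ is the volume of the $s$-dimensional Euclidean unit ball. The Boolean model with intensity $\alpha$ and radii distribution $\mathsf Q$ is the random closed set $\mathcal C=\bigcup_{i\ge1}B(x_i,r_i)\subseteq\mathbb{R}^d$, where $\sum_{i\ge 1}\delta_{(x_i,r_i)}$ is a Poisson point process on $\mathbb{R}^d\times\mathbb{R}_+$ with intensity measure $\alpha\,dx\otimes\mathsf Q$ and $B(x,t)$ is the closed Euclidean ball of radius $t$ centered at $x$. For $r>0$, $f(r)$ is the probability that the line segment $[0,re_1]$ is disjoint from $\mathcal C$ ($e_1$ is the first canonical basis vector), and $P_{\mathrm{vis}}(r)$ is the probability that there exists $y\in\mathbb{R}^d$ with $\|y\|=r$ such that the line segment $[0,y]$ is disjoint from $\mathcal C$. *)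

theory Defs
  imports "HOL-Probability.Probability"
begin

(* The value in A of the random counting measure sum_i delta_(Z_i). *)
definition point_count :: "(nat \<Rightarrow> 'w \<Rightarrow> 'p) \<Rightarrow> 'p set \<Rightarrow> 'w \<Rightarrow> ennreal" where
  "point_count Z A w = (\<Sum>i. indicator A (Z i w))"

(* The sequence Z enumerates the atoms of a Poisson process with intensity measure S: counts are
   Poisson distributed, with the convention that the Poisson law with mean infinity is the point
   mass at infinity, and counts over disjoint sets are independent.  The probabilities are
   written out because poisson_pmf is only specified for positive means.  Enumerating by all of
   nat presupposes infinitely many points, which is automatic if S has infinite total mass. *)
definition poisson_process :: "'w measure \<Rightarrow> 'p measure \<Rightarrow> (nat \<Rightarrow> 'w \<Rightarrow> 'p) \<Rightarrow> bool" where
  "poisson_process M S Z \<longleftrightarrow>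
     prob_space M \<and>
     (\<forall>i. Z i \<in> measurable M S) \<and>
     (\<forall>A\<in>sets S. emeasure S A < \<infinity> \<longrightarrow>
        (\<forall>n::nat. measure M {w \<in> space M. point_count Z A w = of_nat n}
                  = measure S A ^ n / fact n * exp (- measure S A))) \<and>
     (\<forall>A\<in>sets S. emeasure S A = \<infinity> \<longrightarrow> (AE w in M. point_count Z A w = \<infinity>)) \<and>
     (\<forall>(J::nat set) A. finite J \<and> (\<forall>j\<in>J. A j \<in> sets S) \<and> disjoint_family_on A J \<longrightarrow>
        prob_space.indep_vars M (\<lambda>_. borel) (\<lambda>j. point_count Z (A j)) J)"

definition boolean_intensity ::
    "real \<Rightarrow> real measure \<Rightarrow> ('a::euclidean_space \<times> real) measure" where
  "boolean_intensity \<alpha> Q = scale_measure (ennreal \<alpha>) (lborel \<Otimes>\<^sub>M Q)"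

definition boolean_model ::
    "(nat \<Rightarrow> 'w \<Rightarrow> ('a::euclidean_space \<times> real)) \<Rightarrow> 'w \<Rightarrow> 'a set" where
  "boolean_model Z w = (\<Union>i. cball (fst (Z i w)) (snd (Z i w)))"

definition seg_prob ::
    "'w measure \<Rightarrow> ('w \<Rightarrow> 'a::euclidean_space set) \<Rightarrow> 'a \<Rightarrow> real \<Rightarrow> real" where
  "seg_prob M C e r = measure M {w \<in> space M. closed_segment 0 (r *\<^sub>R e) \<inter> C w = {}}"

(* The event is an uncountable union over y.  It is measurable up to null sets (when balls are
   almost surely locally finite it agrees with a union over a countable dense set of directions),
   hence the completion of M. *)
definition vis_prob ::
    "'w measure \<Rightarrow> ('w \<Rightarrow> 'a::euclidean_space set) \<Rightarrow> real \<Rightarrow> real" where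
  "vis_prob M C r =
     measure (completion M) {w \<in> space M. \<exists>y. norm y = r \<and> closed_segment 0 y \<inter> C w = {}}"

end

theory Submission
  imports Defs "HOL-Real_Asymp.Real_Asymp"
begin

text \<open>
  A segment \<open>[0, y]\<close> misses the Boolean model iff the Poisson process has no point \<open>(x, \<rho>)\<close> with
  \<open>dist (x, [0, y]) \<le> \<rho>\<close>, an event of probability \<open>exp (- \<alpha> E V)\<close>, where \<open>V\<close> is the volume of
  the \<open>\<rho>\<close>-neighbourhood of the segment.  Comparing that neighbourhood with the inscribed and the
  circumscribed cylinder gives \<open>\<parallel>y\<parallel> \<kappa> \<rho>^(d-1) \<le> V \<le> (\<parallel>y\<parallel> + 2 \<rho>) \<kappa> \<rho>^(d-1)\<close>, with \<open>\<kappa>\<close> the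
  volume of the unit ball in dimension \<open>d - 1\<close> (lemma \<open>emeasure_tube\<close>).  The upper bound on \<open>V\<close> yields the
  lower bound on \<open>f\<close>, and \<open>f \<le> P_vis\<close> because the direction \<open>e_1\<close> is one of the directions
  in which one may look.

  It remains to bound \<open>P_vis\<close> from above.  Fix \<open>\<delta> > 0\<close>.  If \<open>[0, y]\<close> avoids all the balls and
  \<open>\<parallel>y - z\<parallel> \<le> \<delta>\<close>, then \<open>[0, z]\<close> avoids the balls with radii reduced by \<open>\<delta>\<close> (lemma \<open>clear_perturb\<close>).  A
  \<open>\<delta>\<close>-net of the ball of radius \<open>r\<close> has polynomially many points in \<open>r\<close>
  (lemma \<open>finite_net_of_ball\<close>), so a union bound gives
  \<open>P_vis(r) \<le> poly(r) * exp (- \<alpha> \<kappa> (r - \<delta>) E (\<rho> - \<delta>)\<^sub>+^(d-1))\<close> (lemma \<open>vis_prob_le\<close>).  The polynomial is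
  invisible on the exponential scale, and \<open>E (\<rho> - \<delta>)\<^sub>+^(d-1)\<close> tends to \<open>E \<rho>^(d-1)\<close> as \<open>\<delta>\<close> tends
  to \<open>0\<close>.

  The moment of order \<open>d\<close> enters twice: it makes \<open>E V\<close> finite, and it makes the number of balls that
  meet a bounded set almost surely finite.  The latter shows that the visibility event belongs to
  the completed \<open>\<sigma>\<close>-algebra (lemma \<open>sets_visible\<close>), so that \<open>P_vis\<close> is the measure of a measurable set.
\<close>

section \<open>Neighbourhoods of a segment\<close>

text \<open>
  Points with the same parameter on the two segments are at most \<open>norm (y - z)\<close> apart.  All
  comparisons between different viewing directions below reduce to this estimate.
\<close>

lemma infdist_segment_lipschitz:
  fixes x y z :: "'a::real_normed_vector"
  shows "infdist x (closed_segment 0 z) \<le> infdist x (closed_segment 0 y) + norm (y - z)"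
proof -
  have "infdist x (closed_segment 0 z) - norm (y - z) \<le> dist x p" if p: "p \<in> closed_segment 0 y" for p
  proof -
    from p obtain t where t: "0 \<le> t" "t \<le> 1" "p = t *\<^sub>R y"
      by (auto simp: closed_segment_def)
    have "infdist x (closed_segment 0 z) \<le> dist x (t *\<^sub>R z)"
      by (rule infdist_le) (use t in \<open>auto simp: closed_segment_def\<close>)
    also have "\<dots> \<le> dist x p + dist p (t *\<^sub>R z)"
      by (rule dist_triangle)
    also have "dist p (t *\<^sub>R z) = t * norm (y - z)"
      using t by (simp add: dist_norm flip: scaleR_diff_right)
    also have "\<dots> \<le> norm (y - z)"
      using t by (simp add: mult_left_le_one_le)
    finally show ?thesis by simp
  qed
  then have "infdist x (closed_segment 0 z) - norm (y - z) \<le> infdist x (closed_segment 0 y)"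
    unfolding infdist_def[of x "closed_segment 0 y"] by (auto intro!: cINF_greatest)
  then show ?thesis by simp
qed

lemma segment_meets_cball_iff:
  fixes x y :: "'a::euclidean_space"
  shows "closed_segment 0 y \<inter> cball x \<rho> \<noteq> {} \<longleftrightarrow> infdist x (closed_segment 0 y) \<le> \<rho>"
proof
  assume "closed_segment 0 y \<inter> cball x \<rho> \<noteq> {}"
  then show "infdist x (closed_segment 0 y) \<le> \<rho>"
    by (auto intro: infdist_le2)
next
  assume *: "infdist x (closed_segment 0 y) \<le> \<rho>"
  obtain p where "p \<in> closed_segment 0 y" "infdist x (closed_segment 0 y) = dist x p"
    using infdist_attains_inf[of "closed_segment 0 y" x] by auto
  with * show "closed_segment 0 y \<inter> cball x \<rho> \<noteq> {}"
    by auto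
qed

text \<open>
  Separating the coordinate along the axis from the transversal ones turns the distance to a segment
  on a coordinate axis into a condition that cylinders can be compared with.
\<close>

lemma dist_scaleR_Basis:
  fixes x :: "'a::euclidean_space"
  assumes b: "b \<in> Basis"
  shows "dist x (t *\<^sub>R b) = sqrt ((x \<bullet> b - t)\<^sup>2 + (\<Sum>i\<in>Basis - {b}. (x \<bullet> i)\<^sup>2))"
proof -
  have "dist x (t *\<^sub>R b) = sqrt (\<Sum>i\<in>Basis. (dist (x \<bullet> i) ((t *\<^sub>R b) \<bullet> i))\<^sup>2)"
    by (subst euclidean_dist_l2) (simp add: L2_set_def)
  also have "(\<Sum>i\<in>Basis. (dist (x \<bullet> i) ((t *\<^sub>R b) \<bullet> i))\<^sup>2)
      = (x \<bullet> b - t)\<^sup>2 + (\<Sum>i\<in>Basis - {b}. (dist (x \<bullet> i) ((t *\<^sub>R b) \<bullet> i))\<^sup>2)"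
    using b by (subst sum.remove[of _ b]) (auto simp: dist_real_def)
  also have "(\<Sum>i\<in>Basis - {b}. (dist (x \<bullet> i) ((t *\<^sub>R b) \<bullet> i))\<^sup>2) = (\<Sum>i\<in>Basis - {b}. (x \<bullet> i)\<^sup>2)"
    using b by (intro sum.cong) (auto simp: dist_real_def inner_Basis)
  finally show ?thesis .
qed

definition cylinder :: "'a::euclidean_space \<Rightarrow> real \<Rightarrow> real \<Rightarrow> real \<Rightarrow> 'a set" where
  "cylinder b lo hi \<rho> = {x. x \<bullet> b \<in> {lo..hi} \<and> sqrt (\<Sum>i\<in>Basis - {b}. (x \<bullet> i)\<^sup>2) \<le> \<rho>}"

lemma sets_cylinder [measurable]: "cylinder b lo hi \<rho> \<in> sets borel"
  unfolding cylinder_def by measurable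

text \<open>
  Lebesgue measure is a product measure over the coordinates, so the axial coordinate can be split
  off; the transversal ones then range over a ball in one dimension less.
\<close>

lemma emeasure_cylinder:
  fixes b :: "'a::euclidean_space"
  assumes b: "b \<in> Basis" and "lo \<le> hi" "\<rho> > 0"
  shows "emeasure lborel (cylinder b lo hi \<rho>)
           = ennreal ((hi - lo) * (unit_ball_vol (real (DIM('a) - 1)) * \<rho> ^ (DIM('a) - 1)))"
proof -
  interpret product_sigma_finite "\<lambda>_::'a. lborel :: real measure"
    by standard
  define B where "B = (Basis - {b} :: 'a set)"
  have B: "finite B" "b \<notin> B" "insert b B = Basis" "card B = DIM('a) - 1"
    using b by (auto simp: B_def)
  define D where "D = {f. sqrt (\<Sum>i\<in>B. (f i)\<^sup>2) \<le> \<rho>} \<inter> space (Pi\<^sub>M B (\<lambda>_. lborel :: real measure))"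
  have D[measurable]: "D \<in> sets (Pi\<^sub>M B (\<lambda>_. lborel))"
    unfolding D_def by measurable
  have coord: "(\<Sum>i\<in>Basis. f i *\<^sub>R i) \<bullet> j = f j" if "j \<in> Basis" for f and j :: 'a
    using that by (simp add: inner_sum_left inner_Basis if_distrib cong: if_cong)
  define E where "E = {f. f b \<in> {lo..hi} \<and> sqrt (\<Sum>i\<in>B. (f i)\<^sup>2) \<le> \<rho>} \<inter> space (Pi\<^sub>M (insert b B) (\<lambda>_. lborel :: real measure))"
  have E[measurable]: "E \<in> sets (Pi\<^sub>M (insert b B) (\<lambda>_. lborel))"
    unfolding E_def by measurable
  have "emeasure lborel (cylinder b lo hi \<rho>)
      = emeasure (distr (Pi\<^sub>M Basis (\<lambda>_. lborel)) borel (\<lambda>f. \<Sum>i\<in>Basis. f i *\<^sub>R i)) (cylinder b lo hi \<rho>)"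
    by (subst lborel_eq) simp
  also have "\<dots> = emeasure (Pi\<^sub>M (insert b B) (\<lambda>_. lborel)) E"
    by (subst emeasure_distr)
       (auto simp: cylinder_def E_def B coord b B_def[symmetric] intro!: arg_cong2[where f = emeasure] sum.cong
          simp del: space_PiM, auto simp: B_def coord)
  also have "\<dots> = (\<integral>\<^sup>+ f. indicator E f \<partial>Pi\<^sub>M (insert b B) (\<lambda>_. lborel))"
    by simp
  also have "\<dots> = (\<integral>\<^sup>+ t. \<integral>\<^sup>+ f. indicator E (f(b := t)) \<partial>Pi\<^sub>M B (\<lambda>_. lborel) \<partial>lborel)"
    by (rule product_nn_integral_insert_rev) (use B(1,2) E in auto)
  also have "\<dots> = (\<integral>\<^sup>+ t. \<integral>\<^sup>+ f. indicator {lo..hi} t * indicator D f \<partial>Pi\<^sub>M B (\<lambda>_. lborel) \<partial>lborel)"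
  proof (intro nn_integral_cong)
    fix t :: real and f :: "'a \<Rightarrow> real"
    assume f: "f \<in> space (Pi\<^sub>M B (\<lambda>_. lborel))"
    have "(\<Sum>i\<in>B. ((f(b := t)) i)\<^sup>2) = (\<Sum>i\<in>B. (f i)\<^sup>2)"
      using B by (intro sum.cong) auto
    then show "indicator E (f(b := t)) = (indicator {lo..hi} t * indicator D f :: ennreal)"
      using f by (auto simp: E_def D_def indicator_def space_PiM PiE_def)
  qed
  also have "\<dots> = (\<integral>\<^sup>+ t. indicator {lo..hi} t * emeasure (Pi\<^sub>M B (\<lambda>_. lborel)) D \<partial>lborel)"
    by (simp add: nn_integral_cmult)
  also have "\<dots> = ennreal (hi - lo) * emeasure (Pi\<^sub>M B (\<lambda>_. lborel)) D"
    using assms by (simp add: nn_integral_multc)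
  also have "emeasure (Pi\<^sub>M B (\<lambda>_. lborel)) D
      = ennreal (unit_ball_vol (real (DIM('a) - 1)) * \<rho> ^ (DIM('a) - 1))"
    unfolding D_def using emeasure_cball_aux[OF B(1) \<open>\<rho> > 0\<close>] by (simp add: B)
  finally show ?thesis
    using assms by (simp add: ennreal_mult')
qed

definition tube :: "'a::euclidean_space \<Rightarrow> real \<Rightarrow> 'a set" where
  "tube y \<rho> = {x. infdist x (closed_segment 0 y) \<le> \<rho>}"

lemma compact_tube: "compact (tube y \<rho>)"
proof -
  have "closed (tube y \<rho>)"
    unfolding tube_def by (intro closed_Collect_le continuous_intros)
  moreover have "tube y \<rho> \<subseteq> cball 0 (norm y + \<rho>)"
  proof
    fix x assume "x \<in> tube y \<rho>"
    then have "infdist x {0} \<le> \<rho> + norm y"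
      using infdist_segment_lipschitz[of x 0 y] by (auto simp: tube_def)
    then show "x \<in> cball 0 (norm y + \<rho>)"
      by simp
  qed
  ultimately show ?thesis
    using compact_eq_bounded_closed bounded_subset bounded_cball by blast
qed

lemma sets_tube [measurable]: "tube y \<rho> \<in> sets borel"
  using compact_tube borel_compact by blast

text \<open>
  The uniqueness argument for Haar measure.  The image of Lebesgue measure under \<open>f\<close> is again
  translation invariant; evaluating the mass of pairs \<open>(x, z)\<close> with \<open>x \<in> B\<close> and \<open>x + f z \<in> A\<close> in both
  orders of integration shows that it is proportional to Lebesgue measure, and the factor is \<open>1\<close>
  because \<open>f\<close> preserves the unit ball \<open>B\<close>.
\<close>

lemma emeasure_lborel_vimage_orthogonal:
  fixes f :: "'a::euclidean_space \<Rightarrow> 'a"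
  assumes f: "orthogonal_transformation f" and A[measurable]: "A \<in> sets borel"
  shows "emeasure lborel (f -` A) = emeasure lborel A"
proof -
  have lin: "linear f" and surj: "surj f" and iso: "\<And>a b. dist (f a) (f b) = dist a b"
    using f by (auto simp: orthogonal_transformation_linear orthogonal_transformation_surj
        orthogonal_transformation_isometry)
  have [measurable]: "f \<in> borel_measurable borel"
    by (intro borel_measurable_continuous_onI linear_continuous_on) (use lin in \<open>simp add: linear_conv_bounded_linear\<close>)
  have shift: "(\<integral>\<^sup>+x. g (x + c) \<partial>lborel) = (\<integral>\<^sup>+x. g x \<partial>lborel)"
    if [measurable]: "g \<in> borel_measurable borel" for g :: "'a \<Rightarrow> ennreal" and c
    using lborel_distr_plus[of c] nn_integral_distr[of "(+) c" lborel borel g]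
    by (simp add: add.commute)
  define B where "B = (cball 0 1 :: 'a set)"
  have [measurable]: "B \<in> sets borel"
    by (simp add: B_def)
  have B: "emeasure lborel (cball c 1 :: 'a set) = emeasure lborel B" for c
    by (simp add: B_def emeasure_cball)
  have "emeasure lborel B * emeasure lborel (f -` A)
      = (\<integral>\<^sup>+x. indicator B x * emeasure lborel (f -` A) \<partial>lborel)"
    by (simp add: nn_integral_multc)
  also have "\<dots> = (\<integral>\<^sup>+x. \<integral>\<^sup>+z. indicator B x * indicator A (x + f z) \<partial>lborel \<partial>lborel)"
  proof (rule nn_integral_cong)
    fix x
    obtain x' where x': "x = f x'" using surj by (auto simp: surj_def)
    have "(\<integral>\<^sup>+z. indicator A (x + f z) \<partial>lborel) = (\<integral>\<^sup>+z. indicator (f -` A) (z + x') \<partial>lborel)"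
      by (intro nn_integral_cong) (simp add: x' indicator_def linear_add[OF lin] add.commute)
    also have "\<dots> = (\<integral>\<^sup>+z. indicator (f -` A) z \<partial>lborel)"
      by (rule shift) (use measurable_sets[of f borel borel A] in auto)
    also have "\<dots> = emeasure lborel (f -` A)"
      using measurable_sets[of f borel borel A] by (intro nn_integral_indicator) auto
    finally show "indicator B x * emeasure lborel (f -` A) = (\<integral>\<^sup>+z. indicator B x * indicator A (x + f z) \<partial>lborel)"
      by (simp add: nn_integral_cmult)
  qed
  also have "\<dots> = (\<integral>\<^sup>+z. \<integral>\<^sup>+x. indicator B x * indicator A (x + f z) \<partial>lborel \<partial>lborel)"
    by (rule lborel_pair.Fubini') measurable
  also have "\<dots> = (\<integral>\<^sup>+z. \<integral>\<^sup>+x. indicator B (x - f z) * indicator A x \<partial>lborel \<partial>lborel)"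
    using shift[of "\<lambda>x. indicator B (x - f z) * indicator A x" "f z" for z] by simp
  also have "\<dots> = (\<integral>\<^sup>+x. \<integral>\<^sup>+z. indicator B (x - f z) * indicator A x \<partial>lborel \<partial>lborel)"
    by (rule lborel_pair.Fubini') measurable
  also have "\<dots> = (\<integral>\<^sup>+x. emeasure lborel B * indicator A x \<partial>lborel)"
  proof (rule nn_integral_cong)
    fix x
    obtain x' where x': "x = f x'" using surj by (auto simp: surj_def)
    have "(\<integral>\<^sup>+z. indicator B (x - f z) \<partial>lborel) = (\<integral>\<^sup>+z. indicator (cball x' 1) z \<partial>lborel)"
      by (intro nn_integral_cong) (simp add: x' B_def indicator_def iso[unfolded dist_norm] dist_norm norm_minus_commute)
    also have "\<dots> = emeasure lborel B"
      by (simp add: B)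
    finally show "(\<integral>\<^sup>+z. indicator B (x - f z) * indicator A x \<partial>lborel) = emeasure lborel B * indicator A x"
      by (simp add: nn_integral_multc)
  qed
  also have "\<dots> = emeasure lborel B * emeasure lborel A"
    by (simp add: nn_integral_cmult)
  finally have "emeasure lborel B * emeasure lborel (f -` A) = emeasure lborel B * emeasure lborel A" .
  moreover have "unit_ball_vol (real DIM('a)) \<noteq> 0"
    by (metis less_irrefl of_nat_0_le_iff unit_ball_vol_pos)
  ultimately show ?thesis
    by (simp add: ennreal_mult_cancel_left B_def emeasure_cball)
qed

lemma emeasure_tube_cong_norm:
  fixes y z :: "real ^ 'n"
  assumes "norm y = norm z"
  shows "emeasure lborel (tube y \<rho>) = emeasure lborel (tube z \<rho>)"
proof -
  obtain f where f: "orthogonal_transformation f" "f y = z"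
    using orthogonal_transformation_exists[OF assms] by blast
  have lin: "linear f" and iso: "\<And>a b. dist (f a) (f b) = dist a b"
    using f(1) by (auto simp: orthogonal_transformation_linear orthogonal_transformation_isometry)
  have seg: "f ` closed_segment 0 y = closed_segment 0 z"
    using closed_segment_linear_image[OF lin, of 0 y] f(2) lin by (simp add: linear_0)
  have "infdist (f x) (closed_segment 0 z) = infdist x (closed_segment 0 y)" for x
    unfolding seg[symmetric] infdist_def by (simp add: image_image iso)
  then have "f -` tube z \<rho> = tube y \<rho>"
    by (auto simp: tube_def)
  then show ?thesis
    using emeasure_lborel_vimage_orthogonal[OF f(1) sets_tube, of z \<rho>] by simp
qed

lemma emeasure_tube_Basis:
  fixes b :: "'a::euclidean_space"
  assumes b: "b \<in> Basis" and r: "r \<ge> 0" and \<rho>: "\<rho> > 0"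
  shows "ennreal (r * (unit_ball_vol (real (DIM('a) - 1)) * \<rho> ^ (DIM('a) - 1)))
           \<le> emeasure lborel (tube (r *\<^sub>R b) \<rho>)" (is ?lower)
    and "emeasure lborel (tube (r *\<^sub>R b) \<rho>)
           \<le> ennreal ((r + 2 * \<rho>) * (unit_ball_vol (real (DIM('a) - 1)) * \<rho> ^ (DIM('a) - 1)))" (is ?upper)
proof -
  have seg: "p \<in> closed_segment 0 (r *\<^sub>R b) \<longleftrightarrow> (\<exists>t\<in>{0..r}. p = t *\<^sub>R b)" for p
  proof
    assume "\<exists>t\<in>{0..r}. p = t *\<^sub>R b"
    then obtain t where t: "0 \<le> t" "t \<le> r" "p = t *\<^sub>R b" by auto
    then show "p \<in> closed_segment 0 (r *\<^sub>R b)"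
      unfolding closed_segment_def
      by (cases "r = 0") (auto intro!: exI[of _ "t / r"])
  qed (use r in \<open>auto simp: closed_segment_def mult_left_le_one_le\<close>)
  have "cylinder b 0 r \<rho> \<subseteq> tube (r *\<^sub>R b) \<rho>"
  proof
    fix x assume x: "x \<in> cylinder b 0 r \<rho>"
    then have "dist x ((x \<bullet> b) *\<^sub>R b) \<le> \<rho>"
      by (simp add: dist_scaleR_Basis[OF b] cylinder_def)
    moreover have "(x \<bullet> b) *\<^sub>R b \<in> closed_segment 0 (r *\<^sub>R b)"
      using x by (auto simp: seg cylinder_def)
    ultimately show "x \<in> tube (r *\<^sub>R b) \<rho>"
      by (auto simp: tube_def intro: infdist_le2)
  qed
  then have "emeasure lborel (cylinder b 0 r \<rho>) \<le> emeasure lborel (tube (r *\<^sub>R b) \<rho>)"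
    by (intro emeasure_mono) auto
  then show ?lower
    using emeasure_cylinder[OF b r \<rho>] by simp
  have "tube (r *\<^sub>R b) \<rho> \<subseteq> cylinder b (- \<rho>) (r + \<rho>) \<rho>"
  proof
    fix x assume x: "x \<in> tube (r *\<^sub>R b) \<rho>"
    obtain p where "p \<in> closed_segment 0 (r *\<^sub>R b)"
        "infdist x (closed_segment 0 (r *\<^sub>R b)) = dist x p"
      using infdist_attains_inf[of "closed_segment 0 (r *\<^sub>R b)" x] by auto
    with x obtain t where t: "t \<in> {0..r}" "dist x (t *\<^sub>R b) \<le> \<rho>"
      by (auto simp: seg tube_def)
    define s where "s = (\<Sum>i\<in>Basis - {b}. (x \<bullet> i)\<^sup>2)"
    have s: "s \<ge> 0" by (auto simp: s_def intro: sum_nonneg)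
    have "sqrt ((x \<bullet> b - t)\<^sup>2 + s) \<le> \<rho>"
      using t(2) by (simp add: dist_scaleR_Basis[OF b] s_def)
    moreover have "sqrt ((x \<bullet> b - t)\<^sup>2) \<le> sqrt ((x \<bullet> b - t)\<^sup>2 + s)" "sqrt s \<le> sqrt ((x \<bullet> b - t)\<^sup>2 + s)"
      using s by (auto intro: real_sqrt_le_mono simp del: real_sqrt_abs)
    ultimately have "\<bar>x \<bullet> b - t\<bar> \<le> \<rho>" "sqrt s \<le> \<rho>"
      unfolding real_sqrt_abs by (linarith, linarith)
    then show "x \<in> cylinder b (- \<rho>) (r + \<rho>) \<rho>"
      using t(1) by (auto simp: cylinder_def s_def)
  qed
  then have "emeasure lborel (tube (r *\<^sub>R b) \<rho>) \<le> emeasure lborel (cylinder b (- \<rho>) (r + \<rho>) \<rho>)"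
    by (intro emeasure_mono) auto
  then show ?upper
    using emeasure_cylinder[OF b, of "- \<rho>" "r + \<rho>" \<rho>] r \<rho> by (simp add: algebra_simps)
qed

text \<open>
  By rotation invariance it suffices to treat a coordinate direction.  The truncation \<open>max 0 \<rho>\<close>
  covers negative \<open>\<rho>\<close>, where the tube is empty: such values occur once radii have been
  reduced by \<open>\<delta>\<close>.
\<close>

lemma emeasure_tube:
  fixes y :: "real ^ 'n" and \<rho> :: real
  assumes dim: "CARD('n) \<ge> 2"
  shows "ennreal (norm y * (unit_ball_vol (real (CARD('n) - 1)) * max 0 \<rho> ^ (CARD('n) - 1)))
           \<le> emeasure lborel (tube y \<rho>)" (is "?lower \<rho>")
    and "emeasure lborel (tube y \<rho>)
           \<le> ennreal ((norm y + 2 * max 0 \<rho>) * (unit_ball_vol (real (CARD('n) - 1)) * max 0 \<rho> ^ (CARD('n) - 1)))"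
      (is "_ \<le> ennreal (?upper \<rho>)")
proof -
  obtain b :: "real ^ 'n" where b: "b \<in> Basis"
    using nonempty_Basis by blast
  have zero: "(0::real) ^ (CARD('n) - 1) = 0"
    using dim by (intro zero_power) auto
  have pos: "?lower \<rho>" "emeasure lborel (tube y \<rho>) \<le> ennreal (?upper \<rho>)" if "\<rho> > 0" for \<rho>
    using emeasure_tube_Basis[OF b norm_ge_zero[of y] that] that
      emeasure_tube_cong_norm[of y "norm y *\<^sub>R b" \<rho>] b
    by simp_all
  show "?lower \<rho>"
  proof (cases "\<rho> > 0")
    case False
    then have "max 0 \<rho> = 0" by simp
    then show ?thesis by (simp only: zero mult_zero_right ennreal_0 zero_le)
  qed (rule pos(1))
  consider "\<rho> > 0" | "\<rho> = 0" | "\<rho> < 0" by linarith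
  then show "emeasure lborel (tube y \<rho>) \<le> ennreal (?upper \<rho>)"
  proof cases
    case 2
    \<comment> \<open>The cylinder formula needs a positive radius; the degenerate tube is the limit of thin ones.\<close>
    have "emeasure lborel (tube y 0) \<le> ennreal (?upper \<epsilon>)" if "\<epsilon> > 0" for \<epsilon>
    proof -
      have "emeasure lborel (tube y 0) \<le> emeasure lborel (tube y \<epsilon>)"
      proof (rule emeasure_mono)
        show "tube y 0 \<subseteq> tube y \<epsilon>"
          using that by (auto simp: tube_def)
      qed simp
      with pos(2)[OF that] show ?thesis by (rule order_trans[rotated])
    qed
    then have "eventually (\<lambda>\<epsilon>. emeasure lborel (tube y 0) \<le> ennreal (?upper \<epsilon>)) (at_right 0)"
      by (auto simp: eventually_at_filter)
    moreover have "((\<lambda>\<epsilon>. ennreal (?upper \<epsilon>)) \<longlongrightarrow> ennreal (?upper 0)) (at_right 0)"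
      by (intro tendsto_ennrealI tendsto_intros)
    ultimately have "emeasure lborel (tube y 0) \<le> ennreal (?upper 0)"
      by (intro tendsto_lowerbound[of _ "ennreal (?upper 0)" "at_right (0::real)"]) auto
    then show ?thesis using 2 by simp
  next
    case 3
    then have "x \<notin> tube y \<rho>" for x
      using infdist_nonneg[of x "closed_segment 0 y"] by (simp add: tube_def)
    then have "tube y \<rho> = {}"
      by blast
    then show ?thesis by simp
  qed (rule pos(2))
qed

section \<open>Nets in a ball\<close>

text \<open>
  The net consists of the lattice points of mesh \<open>\<delta> / d\<close>: rounding each coordinate down moves a
  point by at most \<open>\<delta>\<close> in the \<open>\<ell>\<^sup>1\<close> norm, hence in the Euclidean norm.  Polynomial growth in \<open>r\<close> is
  all that matters later.
\<close>

lemma finite_net_of_ball: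
  fixes r \<delta> :: real
  assumes "\<delta> > 0" "r \<ge> 0"
  obtains G :: "(real ^ 'n) set"
  where "finite G" "real (card G) \<le> (2 * r * CARD('n) / \<delta> + 3) ^ CARD('n)"
    "\<And>y. norm y \<le> r \<Longrightarrow> \<exists>z\<in>G. norm (y - z) \<le> \<delta>"
proof -
  define h where "h = \<delta> / CARD('n)"
  have h: "h > 0" using assms by (simp add: h_def)
  define m where "m = \<lceil>r / h\<rceil>"
  have m: "m \<ge> 0" "r / h \<le> m" "m \<le> r / h + 1"
  proof -
    have "r / h \<ge> 0" using assms h by simp
    then show "m \<ge> 0" "r / h \<le> m" "m \<le> r / h + 1"
      unfolding m_def by linarith+
  qed
  define F where "F = PiE (UNIV :: 'n set) (\<lambda>_. {-m..m})"
  define G where "G = (\<lambda>g. (\<chi> i. h * real_of_int (g i)) :: real ^ 'n) ` F"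
  have "finite F" by (auto simp: F_def intro: finite_PiE)
  then have fin: "finite G" and "card G \<le> card F"
    by (auto simp: G_def intro: card_image_le)
  moreover have "card F = nat (2 * m + 1) ^ CARD('n)"
    by (simp add: F_def card_PiE)
  ultimately have "card G \<le> nat (2 * m + 1) ^ CARD('n)"
    by simp
  then have "real (card G) \<le> real (nat (2 * m + 1)) ^ CARD('n)"
    by (metis of_nat_le_iff of_nat_power)
  also have "\<dots> \<le> (2 * r * CARD('n) / \<delta> + 3) ^ CARD('n)"
  proof (rule power_mono)
    have "r / h = r * CARD('n) / \<delta>" by (simp add: h_def)
    then show "real (nat (2 * m + 1)) \<le> 2 * r * CARD('n) / \<delta> + 3"
      using m by simp
  qed simp
  finally have card: "real (card G) \<le> (2 * r * CARD('n) / \<delta> + 3) ^ CARD('n)" .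
  have "\<exists>z\<in>G. norm (y - z) \<le> \<delta>" if y: "norm y \<le> r" for y :: "real ^ 'n"
  proof (rule bexI)
    let ?z = "(\<chi> i. h * real_of_int \<lfloor>y $ i / h\<rfloor>) :: real ^ 'n"
    have "norm (y - ?z) \<le> (\<Sum>i\<in>UNIV. \<bar>(y - ?z) $ i\<bar>)"
      by (rule norm_le_l1_cart)
    also have "\<dots> \<le> (\<Sum>i\<in>(UNIV :: 'n set). h)"
    proof (rule sum_mono)
      fix i
      have "h * (y $ i / h) - h * real_of_int \<lfloor>y $ i / h\<rfloor> = h * frac (y $ i / h)"
        by (simp add: frac_def algebra_simps)
      moreover have "0 \<le> h * frac (y $ i / h)" "h * frac (y $ i / h) \<le> h * 1"
        using h frac_lt_1[of "y $ i / h"] by (auto intro!: mult_left_mono)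
      ultimately show "\<bar>(y - ?z) $ i\<bar> \<le> h"
        using h by simp
    qed
    also have "\<dots> = \<delta>"
      by (simp add: h_def)
    finally show "norm (y - ?z) \<le> \<delta>" .
    have "\<lfloor>y $ i / h\<rfloor> \<in> {-m..m}" for i
    proof -
      have "\<bar>y $ i\<bar> \<le> r"
        using component_le_norm_cart[of y i] y by linarith
      then have "\<bar>y $ i / h\<bar> \<le> m"
        using h m(2) by (simp add: abs_divide divide_right_mono order_trans[OF divide_right_mono])
      then have "- real_of_int m \<le> y $ i / h" "y $ i / h \<le> real_of_int m"
        unfolding abs_le_iff by linarith+
      then show ?thesis
        by (simp add: le_floor_iff floor_le_iff)
    qed
    then show "?z \<in> G"
      unfolding G_def F_def by (intro image_eqI[of _ _ "\<lambda>i. \<lfloor>y $ i / h\<rfloor>"]) auto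
  qed
  with fin card that show thesis by blast
qed

section \<open>Void probabilities of the Poisson process\<close>

definition excess_moment :: "real measure \<Rightarrow> real \<Rightarrow> nat \<Rightarrow> real" where
  "excess_moment Q \<delta> j = (\<integral>\<rho>. max 0 (\<rho> - \<delta>) ^ j \<partial>Q)"

lemma point_count_eq_emeasure:
  "point_count Z A w = emeasure (count_space UNIV) {i. Z i w \<in> A}"
proof -
  have "point_count Z A w = (\<integral>\<^sup>+i. indicator {i. Z i w \<in> A} i \<partial>count_space UNIV)"
    unfolding point_count_def nn_integral_count_space_nat by (intro arg_cong[where f = suminf] ext) (simp add: indicator_def)
  then show ?thesis by simp
qed

lemma point_count_eq_0_iff: "point_count Z A w = 0 \<longleftrightarrow> (\<forall>i. Z i w \<notin> A)"
  unfolding point_count_eq_emeasure by (auto simp: emeasure_count_space_eq_0)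

lemma finite_if_point_count_eq: "point_count Z A w = of_nat n \<Longrightarrow> finite {i. Z i w \<in> A}"
  unfolding point_count_eq_emeasure by (rule ccontr) auto

locale poisson_boolean_model =
  fixes M :: "'w measure"
    and Z :: "nat \<Rightarrow> 'w \<Rightarrow> (real ^ 'n) \<times> real"
    and Q :: "real measure"
    and \<alpha> :: real
  assumes dim: "CARD('n) \<ge> 2"
    and alpha: "\<alpha> > 0"
    and Q_prob: "prob_space Q"
    and Q_sets: "sets Q = sets (restrict_space borel {0..})"
    and poisson: "poisson_process M (boolean_intensity \<alpha> Q) Z"
    and moment: "integrable Q (\<lambda>\<rho>. \<rho> ^ CARD('n))"
begin

sublocale Q: prob_space Q by (rule Q_prob)

sublocale M: prob_space M using poisson by (simp add: poisson_process_def)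

abbreviation S :: "((real ^ 'n) \<times> real) measure" where
  "S \<equiv> boolean_intensity \<alpha> Q"

lemma space_Q: "space Q = {0..}"
  using sets_eq_imp_space_eq[OF Q_sets] by (simp add: space_restrict_space)

lemma measurable_radius [measurable]: "(\<lambda>\<rho>. \<rho>) \<in> borel_measurable Q"
proof -
  have "(\<lambda>\<rho>::real. \<rho>) \<in> borel_measurable (restrict_space borel {0..})"
    by (rule measurable_restrict_space1) simp
  then show ?thesis
    using measurable_cong_sets[OF Q_sets refl] by blast
qed

text \<open>
  Negative \<open>\<delta>\<close> is allowed, so that enlarged radii are covered too.
\<close>

lemma integrable_excess:
  assumes "j \<le> CARD('n)"
  shows "integrable Q (\<lambda>\<rho>. max 0 (\<rho> - \<delta>) ^ j)"
proof (rule Bochner_Integration.integrable_bound)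
  show "integrable Q (\<lambda>\<rho>. 2 ^ CARD('n) * ((1 + \<bar>\<delta>\<bar>) ^ CARD('n) + \<rho> ^ CARD('n)))"
    using moment by (intro integrable_mult_right Bochner_Integration.integrable_add) auto
  show "(\<lambda>\<rho>. max 0 (\<rho> - \<delta>) ^ j) \<in> borel_measurable Q"
    by measurable
  show "AE \<rho> in Q. norm (max 0 (\<rho> - \<delta>) ^ j) \<le> norm (2 ^ CARD('n) * ((1 + \<bar>\<delta>\<bar>) ^ CARD('n) + \<rho> ^ CARD('n)))"
  proof (rule AE_I2)
    fix \<rho> assume "\<rho> \<in> space Q"
    then have \<rho>: "\<rho> \<ge> 0" by (simp add: space_Q)
    define u where "u = max (1 + \<bar>\<delta>\<bar>) \<rho>"
    have u: "1 + \<bar>\<delta>\<bar> \<le> u" "\<rho> \<le> u"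
      by (simp_all add: u_def)
    then have "max 0 (\<rho> - \<delta>) \<le> 2 * u"
      by (intro max.boundedI) linarith+
    then have "max 0 (\<rho> - \<delta>) ^ j \<le> (2 * u) ^ j"
      by (intro power_mono) simp_all
    also have "\<dots> \<le> (2 * u) ^ CARD('n)"
      using assms u by (intro power_increasing) linarith+
    also have "\<dots> = 2 ^ CARD('n) * u ^ CARD('n)"
      by (simp add: power_mult_distrib)
    also have "\<dots> \<le> 2 ^ CARD('n) * ((1 + \<bar>\<delta>\<bar>) ^ CARD('n) + \<rho> ^ CARD('n))"
      using \<rho> by (intro mult_left_mono) (auto simp: u_def max_def)
    finally show "norm (max 0 (\<rho> - \<delta>) ^ j) \<le> norm (2 ^ CARD('n) * ((1 + \<bar>\<delta>\<bar>) ^ CARD('n) + \<rho> ^ CARD('n)))"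
      using \<rho> by (simp add: power_abs)
  qed
qed

lemma excess_moment_nonneg: "excess_moment Q \<delta> j \<ge> 0"
  unfolding excess_moment_def by (intro integral_nonneg_AE AE_I2) auto

lemma excess_moment_0: "excess_moment Q 0 j = (\<integral>\<rho>. \<rho> ^ j \<partial>Q)"
  unfolding excess_moment_def by (intro Bochner_Integration.integral_cong) (auto simp: space_Q)

lemma excess_moment_tendsto:
  "(\<lambda>n. excess_moment Q (1 / real (Suc n)) (CARD('n) - 1)) \<longlonglongrightarrow> excess_moment Q 0 (CARD('n) - 1)"
  unfolding excess_moment_def
proof (rule integral_dominated_convergence)
  show "integrable Q (\<lambda>\<rho>. max 0 (\<rho> - 0) ^ (CARD('n) - 1))"
    by (rule integrable_excess) simp
  have "(\<lambda>n. max 0 (\<rho> - 1 / real (Suc n)) ^ (CARD('n) - 1)) \<longlonglongrightarrow> max 0 (\<rho> - 0) ^ (CARD('n) - 1)" for \<rho> :: real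
    by (intro tendsto_power tendsto_max tendsto_diff tendsto_const LIMSEQ_Suc lim_1_over_n)
  then show "AE \<rho> in Q. (\<lambda>n. max 0 (\<rho> - 1 / real (Suc n)) ^ (CARD('n) - 1)) \<longlonglongrightarrow> max 0 (\<rho> - 0) ^ (CARD('n) - 1)"
    by simp
  show "AE \<rho> in Q. norm (max 0 (\<rho> - 1 / real (Suc n)) ^ (CARD('n) - 1)) \<le> max 0 (\<rho> - 0) ^ (CARD('n) - 1)" for n
  proof (rule AE_I2)
    fix \<rho> :: real
    have "max 0 (\<rho> - 1 / real (Suc n)) \<le> max 0 (\<rho> - 0)"
      by (intro max.mono) simp_all
    then show "norm (max 0 (\<rho> - 1 / real (Suc n)) ^ (CARD('n) - 1)) \<le> max 0 (\<rho> - 0) ^ (CARD('n) - 1)"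
      by (simp add: power_abs power_mono del: of_nat_Suc)
  qed
qed (measurable)

text \<open>
  The marked points whose balls, after reducing all radii by \<open>\<delta>\<close>, meet the segment \<open>[0, y]\<close>.  Keeping
  \<open>\<delta>\<close> an arbitrary real number serves three purposes: \<open>\<delta> = 0\<close> is the original model, a small positive
  \<open>\<delta>\<close> absorbs a change of direction, and \<open>hits 0 (- r)\<close> collects all balls that meet the ball of
  radius \<open>r\<close> around the origin.
\<close>

definition hits :: "real ^ 'n \<Rightarrow> real \<Rightarrow> ((real ^ 'n) \<times> real) set" where
  "hits y \<delta> = {p \<in> space S. infdist (fst p) (closed_segment 0 y) \<le> snd p - \<delta>}"

lemma sets_S: "sets S = sets (lborel \<Otimes>\<^sub>M Q)" and space_S: "space S = UNIV \<times> {0..}"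
  by (simp_all add: boolean_intensity_def space_scale_measure space_pair_measure space_Q)

lemma sets_hits [measurable]: "hits y \<delta> \<in> sets S"
proof -
  have [measurable]: "(\<lambda>x. infdist x (closed_segment 0 y)) \<in> borel_measurable borel"
    by (intro borel_measurable_continuous_onI continuous_intros)
  have [measurable]: "snd \<in> borel_measurable ((lborel :: (real ^ 'n) measure) \<Otimes>\<^sub>M Q)"
    using measurable_compose[OF measurable_snd measurable_radius] by simp
  have "{p \<in> space (lborel \<Otimes>\<^sub>M Q). infdist (fst p) (closed_segment 0 y) \<le> snd p - \<delta>} \<in> sets (lborel \<Otimes>\<^sub>M Q)"
    by measurable
  then show ?thesis
    using sets_eq_imp_space_eq[OF sets_S] by (simp add: hits_def sets_S)
qed

lemma emeasure_hits: "emeasure S (hits y \<delta>) = ennreal \<alpha> * (\<integral>\<^sup>+\<rho>. emeasure lborel (tube y (\<rho> - \<delta>)) \<partial>Q)"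
proof -
  interpret pair_sigma_finite "lborel :: (real ^ 'n) measure" Q ..
  have "emeasure S (hits y \<delta>) = ennreal \<alpha> * emeasure (lborel \<Otimes>\<^sub>M Q) (hits y \<delta>)"
    by (simp add: boolean_intensity_def)
  also have "emeasure (lborel \<Otimes>\<^sub>M Q) (hits y \<delta>) = (\<integral>\<^sup>+\<rho>. emeasure lborel ((\<lambda>x. (x, \<rho>)) -` hits y \<delta>) \<partial>Q)"
    using sets_hits by (intro emeasure_pair_measure_alt2) (simp add: sets_S)
  also have "\<dots> = (\<integral>\<^sup>+\<rho>. emeasure lborel (tube y (\<rho> - \<delta>)) \<partial>Q)"
    by (intro nn_integral_cong arg_cong2[where f = emeasure])
       (auto simp: hits_def tube_def space_S space_Q)
  finally show ?thesis .
qed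

text \<open>
  Since \<open>(norm y + 2 t) t^(d-1) = norm y t^(d-1) + 2 t^d\<close>, the end caps of the segment cost a moment
  of order \<open>d\<close>, but no power of the length.
\<close>

lemma emeasure_hits_le:
  "emeasure S (hits y \<delta>) \<le> ennreal (\<alpha> * (unit_ball_vol (real (CARD('n) - 1)) * (norm y * excess_moment Q \<delta> (CARD('n) - 1) + 2 * excess_moment Q \<delta> (CARD('n)))))"
proof -
  let ?s = "\<lambda>\<rho>. max 0 (\<rho> - \<delta>)"
  have int: "integrable Q (\<lambda>\<rho>. norm y * ?s \<rho> ^ (CARD('n) - 1) + 2 * ?s \<rho> ^ CARD('n))"
    by (intro Bochner_Integration.integrable_add integrable_mult_right integrable_excess) auto
  have eq: "(norm y + 2 * t) * (unit_ball_vol (real (CARD('n) - 1)) * t ^ (CARD('n) - 1)) = unit_ball_vol (real (CARD('n) - 1)) * (norm y * t ^ (CARD('n) - 1) + 2 * t ^ CARD('n))" for t :: real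
    by (subst power_eq_if[of t "CARD('n)"]) (simp add: algebra_simps)
  have "(\<integral>\<^sup>+\<rho>. emeasure lborel (tube y (\<rho> - \<delta>)) \<partial>Q)
      \<le> (\<integral>\<^sup>+\<rho>. ennreal (unit_ball_vol (real (CARD('n) - 1)) * (norm y * ?s \<rho> ^ (CARD('n) - 1) + 2 * ?s \<rho> ^ CARD('n))) \<partial>Q)"
    using emeasure_tube(2)[OF dim, of y] unfolding eq by (intro nn_integral_mono)
  also have "\<dots> = ennreal (\<integral>\<rho>. unit_ball_vol (real (CARD('n) - 1)) * (norm y * ?s \<rho> ^ (CARD('n) - 1) + 2 * ?s \<rho> ^ CARD('n)) \<partial>Q)"
    by (intro nn_integral_eq_integral integrable_mult_right int) simp
  also have "(\<integral>\<rho>. unit_ball_vol (real (CARD('n) - 1)) * (norm y * ?s \<rho> ^ (CARD('n) - 1) + 2 * ?s \<rho> ^ CARD('n)) \<partial>Q)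
      = unit_ball_vol (real (CARD('n) - 1)) * (norm y * excess_moment Q \<delta> (CARD('n) - 1) + 2 * excess_moment Q \<delta> (CARD('n)))"
    unfolding excess_moment_def
    by (simp add: integrable_excess Bochner_Integration.integral_add)
  finally have "ennreal \<alpha> * (\<integral>\<^sup>+\<rho>. emeasure lborel (tube y (\<rho> - \<delta>)) \<partial>Q)
      \<le> ennreal \<alpha> * ennreal (unit_ball_vol (real (CARD('n) - 1)) * (norm y * excess_moment Q \<delta> (CARD('n) - 1) + 2 * excess_moment Q \<delta> (CARD('n))))"
    by (rule mult_left_mono) simp
  then show ?thesis
    using alpha unfolding emeasure_hits by (simp add: ennreal_mult')
qed

lemma emeasure_hits_finite: "emeasure S (hits y \<delta>) < \<infinity>"
  using emeasure_hits_le[of y \<delta>] by (rule le_less_trans) simp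

lemma measure_hits_le:
  "measure S (hits y \<delta>) \<le> \<alpha> * (unit_ball_vol (real (CARD('n) - 1)) * (norm y * excess_moment Q \<delta> (CARD('n) - 1) + 2 * excess_moment Q \<delta> (CARD('n))))"
  unfolding measure_def using emeasure_hits_le[of y \<delta>] alpha
  by (intro enn2real_leI) (auto intro!: mult_nonneg_nonneg add_nonneg_nonneg excess_moment_nonneg)

lemma measure_hits_ge:
  "\<alpha> * (unit_ball_vol (real (CARD('n) - 1)) * (norm y * excess_moment Q \<delta> (CARD('n) - 1))) \<le> measure S (hits y \<delta>)"
proof -
  let ?s = "\<lambda>\<rho>. max 0 (\<rho> - \<delta>)"
  have "ennreal (norm y * (unit_ball_vol (real (CARD('n) - 1)) * excess_moment Q \<delta> (CARD('n) - 1))) = ennreal (\<integral>\<rho>. norm y * (unit_ball_vol (real (CARD('n) - 1)) * ?s \<rho> ^ (CARD('n) - 1)) \<partial>Q)"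
    by (simp add: excess_moment_def)
  also have "\<dots> = (\<integral>\<^sup>+\<rho>. ennreal (norm y * (unit_ball_vol (real (CARD('n) - 1)) * ?s \<rho> ^ (CARD('n) - 1))) \<partial>Q)"
    by (intro nn_integral_eq_integral[symmetric] integrable_mult_right integrable_excess) auto
  also have "\<dots> \<le> (\<integral>\<^sup>+\<rho>. emeasure lborel (tube y (\<rho> - \<delta>)) \<partial>Q)"
    using emeasure_tube(1)[OF dim, of y] by (intro nn_integral_mono)
  finally have "ennreal \<alpha> * ennreal (norm y * (unit_ball_vol (real (CARD('n) - 1)) * excess_moment Q \<delta> (CARD('n) - 1))) \<le> emeasure S (hits y \<delta>)"
    unfolding emeasure_hits by (rule mult_left_mono) simp
  also have "\<dots> = ennreal (measure S (hits y \<delta>))"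
    using emeasure_hits_finite[of y \<delta>] by (intro emeasure_eq_ennreal_measure) auto
  finally have "ennreal (\<alpha> * (norm y * (unit_ball_vol (real (CARD('n) - 1)) * excess_moment Q \<delta> (CARD('n) - 1)))) \<le> ennreal (measure S (hits y \<delta>))"
    using alpha by (simp add: ennreal_mult')
  then show ?thesis
    by (subst (asm) ennreal_le_iff) (auto simp: mult_ac)
qed

definition clear :: "real ^ 'n \<Rightarrow> real \<Rightarrow> 'w set" where
  "clear y \<delta> = {w \<in> space M. \<forall>i. Z i w \<notin> hits y \<delta>}"

lemma measurable_Z [measurable]: "Z i \<in> measurable M S"
  using poisson by (simp add: poisson_process_def)

lemma sets_clear [measurable]: "clear y \<delta> \<in> sets M"
  unfolding clear_def by measurable

lemma prob_point_count:
  "measure M {w \<in> space M. point_count Z (hits y \<delta>) w = of_nat n}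
     = measure S (hits y \<delta>) ^ n / fact n * exp (- measure S (hits y \<delta>))"
proof -
  have "\<forall>A\<in>sets S. emeasure S A < \<infinity> \<longrightarrow>
      (\<forall>n. measure M {w \<in> space M. point_count Z A w = of_nat n} = measure S A ^ n / fact n * exp (- measure S A))"
    using poisson unfolding poisson_process_def by (elim conjE)
  from this[rule_format, OF sets_hits emeasure_hits_finite] show ?thesis .
qed

lemma prob_clear: "measure M (clear y \<delta>) = exp (- measure S (hits y \<delta>))"
  using prob_point_count[of y \<delta> 0] by (simp add: clear_def point_count_eq_0_iff)

text \<open>
  A Poisson law with finite mean gives full mass to the natural numbers.
\<close>

lemma AE_finite_hits: "AE w in M. finite {i. Z i w \<in> hits y \<delta>}"
proof -
  let ?m = "measure S (hits y \<delta>)"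
  define E where "E = (\<lambda>n::nat. {w \<in> space M. point_count Z (hits y \<delta>) w = of_nat n})"
  have E[measurable]: "E n \<in> sets M" for n
    unfolding E_def point_count_def by measurable
  have prob: "measure M (E n) = ?m ^ n / fact n * exp (- ?m)" for n
    unfolding E_def by (rule prob_point_count)
  have "disjoint_family E"
    by (auto simp: disjoint_family_on_def E_def)
  then have "(\<lambda>n. measure M (E n)) sums measure M (\<Union>n. E n)"
    using E by (intro M.finite_measure_UNION) auto
  moreover have "(\<lambda>n. measure M (E n)) sums (exp ?m * exp (- ?m))"
    unfolding prob using exp_converges[of ?m]
    by (intro sums_mult2) (simp add: field_simps)
  ultimately have "measure M (\<Union>n. E n) = exp ?m * exp (- ?m)"
    by (rule sums_unique2)
  also have "\<dots> = 1"
    by (simp add: exp_minus)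
  finally have "AE w in M. w \<in> (\<Union>n. E n)"
    by (intro M.AE_prob_1)
  then show ?thesis
    by (rule AE_mp) (auto simp: E_def intro!: AE_I2 dest: finite_if_point_count_eq)
qed

section \<open>Free segments and the visibility event\<close>

lemma clear_iff:
  assumes "w \<in> space M"
  shows "w \<in> clear y \<delta> \<longleftrightarrow> (\<forall>i. snd (Z i w) - \<delta> < infdist (fst (Z i w)) (closed_segment 0 y))"
  using assms measurable_space[OF measurable_Z] by (auto simp: clear_def hits_def not_le)

lemma clear_0_iff:
  assumes "w \<in> space M"
  shows "w \<in> clear y 0 \<longleftrightarrow> closed_segment 0 y \<inter> boolean_model Z w = {}"
proof -
  have "closed_segment 0 y \<inter> boolean_model Z w = {}
      \<longleftrightarrow> (\<forall>i. \<not> (closed_segment 0 y \<inter> cball (fst (Z i w)) (snd (Z i w)) \<noteq> {}))"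
    by (auto simp: boolean_model_def)
  then show ?thesis
    unfolding clear_iff[OF assms] segment_meets_cball_iff by (simp add: not_le)
qed

lemma clear_perturb:
  assumes "w \<in> clear y \<delta>" "norm (y - z) \<le> \<epsilon>"
  shows "w \<in> clear z (\<delta> + \<epsilon>)"
proof -
  have w: "w \<in> space M" using assms(1) by (simp add: clear_def)
  have "snd (Z i w) - (\<delta> + \<epsilon>) < infdist (fst (Z i w)) (closed_segment 0 z)" for i
  proof -
    have "snd (Z i w) - \<delta> < infdist (fst (Z i w)) (closed_segment 0 y)"
      using assms(1) w clear_iff by blast
    then show ?thesis
      using infdist_segment_lipschitz[of "fst (Z i w)" y z] assms(2)
      by (simp add: norm_minus_commute)
  qed
  with w show ?thesis by (simp add: clear_iff)
qed

definition visible :: "real \<Rightarrow> 'w set" where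
  "visible r = {w \<in> space M. \<exists>y. norm y = r \<and> closed_segment 0 y \<inter> boolean_model Z w = {}}"

lemma visible_eq: "visible r = (\<Union>y\<in>sphere 0 r. clear y 0)"
proof -
  have "clear y 0 \<subseteq> space M" for y by (auto simp: clear_def)
  then show ?thesis
    using clear_0_iff by (fastforce simp: visible_def)
qed

text \<open>
  The finitely many balls that reach the ball of radius \<open>r\<close> stay at a positive distance from the free
  segment, so a small rotation keeps it free; the remaining balls cannot meet any segment of length \<open>r\<close>.
\<close>

lemma clear_open:
  assumes w: "w \<in> clear y 0" "norm y = r" and fin: "finite {i. Z i w \<in> hits 0 (- r)}"
  obtains \<epsilon> where "\<epsilon> > 0" "\<And>z. norm z = r \<Longrightarrow> dist z y < \<epsilon> \<Longrightarrow> w \<in> clear z 0"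
proof -
  define F where "F = {i. Z i w \<in> hits 0 (- r)}"
  define g where "g = (\<lambda>i. infdist (fst (Z i w)) (closed_segment 0 y) - snd (Z i w))"
  define \<epsilon> where "\<epsilon> = Min (insert 1 (g ` F))"
  have sp: "w \<in> space M" using w(1) by (simp add: clear_def)
  have g: "g i > 0" for i
    using w(1) clear_iff[OF sp, of y 0] by (simp add: g_def)
  have "\<epsilon> > 0"
    using fin g by (auto simp: \<epsilon>_def F_def)
  moreover have "w \<in> clear z 0" if z: "norm z = r" "dist z y < \<epsilon>" for z
  proof -
    have "snd (Z i w) < infdist (fst (Z i w)) (closed_segment 0 z)" for i
    proof (cases "i \<in> F")
      case True
      then have "\<epsilon> \<le> g i"
        using fin by (auto simp: \<epsilon>_def F_def)
      then show ?thesis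
        using infdist_segment_lipschitz[of "fst (Z i w)" y z] z(2)
        by (simp add: g_def dist_norm)
    next
      case False
      then have "snd (Z i w) + r < infdist (fst (Z i w)) (closed_segment 0 0)"
        using measurable_space[OF measurable_Z sp, of i] by (simp add: F_def hits_def)
      then show ?thesis
        using infdist_segment_lipschitz[of "fst (Z i w)" 0 z] z(1) by simp
    qed
    then show ?thesis by (simp add: clear_iff[OF sp])
  qed
  ultimately show thesis by (rule that)
qed

text \<open>
  Almost surely the set of free directions is open in the sphere by the preceding lemma, hence it is
  nonempty iff it meets a fixed countable dense subset.  Up to a null set the event is therefore a
  countable union of measurable ones.
\<close>

lemma sets_visible: "visible r \<in> sets (completion M)"
proof -
  obtain T where T: "countable T" "T \<subseteq> sphere (0 :: real ^ 'n) r" "sphere 0 r \<subseteq> closure T"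
    using separable[of "sphere (0 :: real ^ 'n) r"] by blast
  define U where "U = (\<Union>y\<in>T. clear y 0)"
  have U: "U \<in> sets M"
    unfolding U_def using T(1) by (intro sets.countable_UN'') auto
  obtain N where N: "{w \<in> space M. \<not> finite {i. Z i w \<in> hits 0 (- r)}} \<subseteq> N" "emeasure M N = 0" "N \<in> sets M"
    using AE_finite_hits[of 0 "- r"] by (rule AE_E)
  have "visible r - U \<subseteq> N"
  proof
    fix w assume w: "w \<in> visible r - U"
    then obtain y where y: "norm y = r" "w \<in> clear y 0"
      by (auto simp: visible_eq)
    have "\<not> finite {i. Z i w \<in> hits 0 (- r)}"
    proof
      assume "finite {i. Z i w \<in> hits 0 (- r)}"
      then obtain \<epsilon> where \<epsilon>: "\<epsilon> > 0" "\<And>z. norm z = r \<Longrightarrow> dist z y < \<epsilon> \<Longrightarrow> w \<in> clear z 0"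
        using clear_open[OF y(2,1)] by blast
      have "y \<in> closure T"
        using T(3) y(1) by auto
      then obtain z where "z \<in> T" "dist z y < \<epsilon>"
        using \<epsilon>(1) by (auto simp: closure_approachable)
      then have "w \<in> U"
        using \<epsilon>(2)[of z] T(2) by (force simp: U_def)
      with w show False by simp
    qed
    with y(2) N(1) show "w \<in> N" by (auto simp: clear_def)
  qed
  then have "visible r - U \<in> sets (completion M)"
    using N by (intro sets_completionI_sub[of N]) (auto simp: null_sets_def)
  moreover have "visible r = U \<union> (visible r - U)"
    using T(2) by (auto simp: U_def visible_eq)
  ultimately show ?thesis
    using U by (metis sets.Un sets_completionI_sets)
qed

lemma seg_prob_eq: "seg_prob M (boolean_model Z) e r = exp (- measure S (hits (r *\<^sub>R e) 0))"
proof -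
  have "{w \<in> space M. closed_segment 0 (r *\<^sub>R e) \<inter> boolean_model Z w = {}} = clear (r *\<^sub>R e) 0"
    using clear_0_iff by (auto simp: clear_def)
  then show ?thesis by (simp add: seg_prob_def prob_clear)
qed

lemma seg_prob_ge:
  assumes "norm e = 1" "r \<ge> 0"
  shows "exp (- (\<alpha> * (unit_ball_vol (real (CARD('n) - 1)) * (r * excess_moment Q 0 (CARD('n) - 1) + 2 * excess_moment Q 0 (CARD('n))))))
           \<le> seg_prob M (boolean_model Z) e r"
  using measure_hits_le[of "r *\<^sub>R e" 0] assms by (simp add: seg_prob_eq)

lemma seg_prob_le_vis_prob:
  assumes "norm e = 1" "r \<ge> 0"
  shows "seg_prob M (boolean_model Z) e r \<le> vis_prob M (boolean_model Z) r"
proof -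
  interpret C: prob_space "completion M" by (rule M.prob_space_completion)
  have "r *\<^sub>R e \<in> sphere 0 r"
    using assms by simp
  then have "measure (completion M) (clear (r *\<^sub>R e) 0) \<le> measure (completion M) (visible r)"
    by (intro C.finite_measure_mono sets_visible) (unfold visible_eq, blast)
  then show ?thesis
    by (simp add: seg_prob_eq vis_prob_def prob_clear sets_clear flip: visible_def)
qed

text \<open>
  A point of the net close to the sphere of radius \<open>r\<close> need not lie on it, but its norm is at least
  \<open>r - \<delta>\<close>, and this is where the factor \<open>r - \<delta>\<close> comes from.
\<close>

lemma vis_prob_le:
  assumes "\<delta> > 0" "r \<ge> 0"
  shows "vis_prob M (boolean_model Z) r \<le> (2 * r * CARD('n) / \<delta> + 3) ^ CARD('n)
           * exp (- (\<alpha> * (unit_ball_vol (real (CARD('n) - 1)) * ((r - \<delta>) * excess_moment Q \<delta> (CARD('n) - 1)))))"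
    (is "_ \<le> ?N * ?p")
proof -
  interpret C: prob_space "completion M" by (rule M.prob_space_completion)
  obtain G :: "(real ^ 'n) set" where G: "finite G" "real (card G) \<le> ?N"
      "\<And>y. norm y \<le> r \<Longrightarrow> \<exists>z\<in>G. norm (y - z) \<le> \<delta>"
    using finite_net_of_ball[OF assms] by blast
  define G' where "G' = {z \<in> G. norm z \<ge> r - \<delta>}"
  have G': "finite G'" "card G' \<le> card G"
    using G(1) by (auto simp: G'_def intro: card_mono)
  have "visible r \<subseteq> (\<Union>z\<in>G'. clear z \<delta>)"
  proof
    fix w assume "w \<in> visible r"
    then obtain y where y: "norm y = r" "w \<in> clear y 0"
      by (auto simp: visible_eq)
    obtain z where z: "z \<in> G" "norm (y - z) \<le> \<delta>"
      using G(3) y(1) by blast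
    have "norm y \<le> norm (y - z) + norm z"
      using norm_triangle_ineq[of "y - z" z] by simp
    then have "z \<in> G'"
      using z y(1) by (simp add: G'_def)
    moreover have "w \<in> clear z \<delta>"
      using clear_perturb[OF y(2) z(2)] by simp
    ultimately show "w \<in> (\<Union>z\<in>G'. clear z \<delta>)" by blast
  qed
  then have "measure (completion M) (visible r) \<le> measure (completion M) (\<Union>z\<in>G'. clear z \<delta>)"
    using G'(1) by (intro C.finite_measure_mono) auto
  also have "\<dots> = measure M (\<Union>z\<in>G'. clear z \<delta>)"
    using G'(1) by (intro measure_completion) auto
  also have "\<dots> \<le> (\<Sum>z\<in>G'. measure M (clear z \<delta>))"
    using G'(1) by (intro M.finite_measure_subadditive_finite) auto
  also have "\<dots> \<le> (\<Sum>z\<in>G'. ?p)"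
  proof (rule sum_mono)
    fix z assume "z \<in> G'"
    then have "\<alpha> * (unit_ball_vol (real (CARD('n) - 1)) * ((r - \<delta>) * excess_moment Q \<delta> (CARD('n) - 1)))
        \<le> \<alpha> * (unit_ball_vol (real (CARD('n) - 1)) * (norm z * excess_moment Q \<delta> (CARD('n) - 1)))"
      using alpha by (intro mult_left_mono mult_right_mono excess_moment_nonneg) (auto simp: G'_def)
    also have "\<dots> \<le> measure S (hits z \<delta>)"
      by (rule measure_hits_ge)
    finally show "measure M (clear z \<delta>) \<le> ?p"
      by (simp add: prob_clear)
  qed
  also have "\<dots> = real (card G') * ?p"
    by simp
  also have "\<dots> \<le> ?N * ?p"
    using G'(2) G(2) by (intro mult_right_mono) auto
  finally show ?thesis
    by (simp add: vis_prob_def flip: visible_def)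
qed

text \<open>
  The normalised logarithms are squeezed between \<open>lo\<close>, which tends to the claimed rate, and \<open>hi \<delta>\<close>,
  which tends to the rate with \<open>\<rho>\<close> replaced by \<open>(\<rho> - \<delta>)\<^sub>+\<close>.  As \<open>\<delta>\<close> stays fixed while \<open>r\<close>
  tends to infinity, the upper bound is obtained for each \<open>a\<close> above the rate separately.
\<close>

lemma log_decay:
  fixes e :: "real ^ 'n"
  assumes e: "norm e = 1"
  shows "((\<lambda>r. 1 / r * ln (vis_prob M (boolean_model Z) r)) \<longlongrightarrow> - \<alpha> * unit_ball_vol (real (CARD('n) - 1)) * excess_moment Q 0 (CARD('n) - 1)) at_top"
    and "((\<lambda>r. 1 / r * ln (seg_prob M (boolean_model Z) e r)) \<longlongrightarrow> - \<alpha> * unit_ball_vol (real (CARD('n) - 1)) * excess_moment Q 0 (CARD('n) - 1)) at_top"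
proof -
  define c where "c = \<alpha> * unit_ball_vol (real (CARD('n) - 1))"
  define L where "L = - c * excess_moment Q 0 (CARD('n) - 1)"
  have c: "c \<ge> 0" using alpha by (simp add: c_def)
  let ?f = "\<lambda>r. seg_prob M (boolean_model Z) e r" and ?v = "\<lambda>r. vis_prob M (boolean_model Z) r"
  define lo where "lo = (\<lambda>r::real. 1 / r * (- (c * (r * excess_moment Q 0 (CARD('n) - 1) + 2 * excess_moment Q 0 (CARD('n))))))"
  define hi where "hi = (\<lambda>(\<delta>::real) (r::real). 1 / r * (CARD('n) * ln (2 * r * CARD('n) / \<delta> + 3) - c * ((r - \<delta>) * excess_moment Q \<delta> (CARD('n) - 1))))"
  have f_pos: "?f r > 0" for r by (simp add: seg_prob_eq)
  have lo_f: "lo r \<le> 1 / r * ln (?f r)" and f_v: "1 / r * ln (?f r) \<le> 1 / r * ln (?v r)"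
    and v_hi: "\<And>\<delta>. \<delta> > 0 \<Longrightarrow> 1 / r * ln (?v r) \<le> hi \<delta> r" if r: "r > 0" for r :: real
  proof -
    have "- (c * (r * excess_moment Q 0 (CARD('n) - 1) + 2 * excess_moment Q 0 (CARD('n)))) \<le> ln (?f r)"
      using seg_prob_ge[OF e, of r] r f_pos[of r] by (subst ln_ge_iff) (auto simp: c_def mult.assoc)
    then show "lo r \<le> 1 / r * ln (?f r)"
      unfolding lo_def using r by (intro mult_left_mono) auto
    have v_pos: "?v r > 0"
      using f_pos[of r] seg_prob_le_vis_prob[OF e, of r] r by linarith
    have "ln (?f r) \<le> ln (?v r)"
      using f_pos[of r] seg_prob_le_vis_prob[OF e, of r] r by (intro ln_mono) auto
    then show "1 / r * ln (?f r) \<le> 1 / r * ln (?v r)"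
      using r by (intro mult_left_mono) auto
    fix \<delta> :: real assume \<delta>: "\<delta> > 0"
    have N: "2 * r * CARD('n) / \<delta> + 3 > 0"
      using r \<delta> by (intro add_nonneg_pos) auto
    have "ln (?v r) \<le> ln ((2 * r * CARD('n) / \<delta> + 3) ^ CARD('n) * exp (- (c * ((r - \<delta>) * excess_moment Q \<delta> (CARD('n) - 1)))))"
      using v_pos vis_prob_le[OF \<delta>, of r] r by (intro ln_mono) (auto simp: c_def mult.assoc)
    also have "\<dots> = CARD('n) * ln (2 * r * CARD('n) / \<delta> + 3) - c * ((r - \<delta>) * excess_moment Q \<delta> (CARD('n) - 1))"
      using N by (simp add: ln_mult_pos ln_realpow)
    finally show "1 / r * ln (?v r) \<le> hi \<delta> r"
      unfolding hi_def using r by (intro mult_left_mono) auto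
  qed
  have lo_lim: "(lo \<longlongrightarrow> L) at_top"
    unfolding lo_def L_def by real_asymp
  have hi_lim: "(hi \<delta> \<longlongrightarrow> - c * excess_moment Q \<delta> (CARD('n) - 1)) at_top" if "\<delta> > 0" for \<delta>
    unfolding hi_def using that by real_asymp
  have v_lim: "((\<lambda>r. 1 / r * ln (?v r)) \<longlongrightarrow> L) at_top"
  proof (rule order_tendstoI)
    fix a assume "a < L"
    then have "eventually (\<lambda>r. a < lo r) at_top"
      by (rule order_tendstoD[OF lo_lim])
    then show "eventually (\<lambda>r. a < 1 / r * ln (?v r)) at_top"
      using eventually_gt_at_top[of "0::real"]
    proof eventually_elim
      case (elim r)
      then show ?case using lo_f[of r] f_v[of r] by linarith
    qed
  next
    fix a assume a: "L < a"
    have "(\<lambda>n. - c * excess_moment Q (1 / real (Suc n)) (CARD('n) - 1)) \<longlonglongrightarrow> L"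
      unfolding L_def by (intro tendsto_mult tendsto_const excess_moment_tendsto)
    then have "eventually (\<lambda>n. - c * excess_moment Q (1 / real (Suc n)) (CARD('n) - 1) < a) sequentially"
      using a by (rule order_tendstoD)
    then obtain n where n: "- c * excess_moment Q (1 / real (Suc n)) (CARD('n) - 1) < a"
      by (auto simp: eventually_sequentially)
    define \<delta> where "\<delta> = 1 / real (Suc n)"
    have \<delta>: "\<delta> > 0" by (simp add: \<delta>_def)
    have "eventually (\<lambda>r. hi \<delta> r < a) at_top"
      using order_tendstoD(2)[OF hi_lim[OF \<delta>]] n by (simp add: \<delta>_def)
    then show "eventually (\<lambda>r. 1 / r * ln (?v r) < a) at_top"
      using eventually_gt_at_top[of "0::real"]
    proof eventually_elim
      case (elim r)
      then show ?case using v_hi[of r \<delta>] \<delta> by linarith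
    qed
  qed
  have f_lim: "((\<lambda>r. 1 / r * ln (?f r)) \<longlongrightarrow> L) at_top"
  proof (rule tendsto_sandwich[OF _ _ lo_lim v_lim])
    show "eventually (\<lambda>r. lo r \<le> 1 / r * ln (?f r)) at_top"
      using eventually_gt_at_top[of "0::real"] by eventually_elim (rule lo_f)
    show "eventually (\<lambda>r. 1 / r * ln (?f r) \<le> 1 / r * ln (?v r)) at_top"
      using eventually_gt_at_top[of "0::real"] by eventually_elim (rule f_v)
  qed
  show "((\<lambda>r. 1 / r * ln (?v r)) \<longlongrightarrow> - \<alpha> * unit_ball_vol (real (CARD('n) - 1)) * excess_moment Q 0 (CARD('n) - 1)) at_top"
    using v_lim by (simp add: L_def c_def)
  show "((\<lambda>r. 1 / r * ln (?f r)) \<longlongrightarrow> - \<alpha> * unit_ball_vol (real (CARD('n) - 1)) * excess_moment Q 0 (CARD('n) - 1)) at_top"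
    using f_lim by (simp add: L_def c_def)
qed

end

theorem mainTheorem2:
  fixes M :: "'w measure"
    and Z :: "nat \<Rightarrow> 'w \<Rightarrow> (real ^ 'n) \<times> real"
    and Q :: "real measure"
    and \<alpha> :: real
    and k :: 'n
  assumes dim: "CARD('n) \<ge> 2"
    and alpha: "\<alpha> > 0"
    and Q_prob: "prob_space Q"
    and Q_sets: "sets Q = sets (restrict_space borel {0..})"
    and poisson: "poisson_process M (boolean_intensity \<alpha> Q) Z"
    and moment: "integrable Q (\<lambda>\<rho>. \<rho> ^ CARD('n))"
  shows "((\<lambda>r. 1 / r * ln (vis_prob M (boolean_model Z) r))
            \<longlongrightarrow> - \<alpha> * unit_ball_vol (real (CARD('n) - 1)) * (\<integral>\<rho>. \<rho> ^ (CARD('n) - 1) \<partial>Q)) at_top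
       \<and> ((\<lambda>r. 1 / r * ln (seg_prob M (boolean_model Z) (axis k 1) r))
            \<longlongrightarrow> - \<alpha> * unit_ball_vol (real (CARD('n) - 1)) * (\<integral>\<rho>. \<rho> ^ (CARD('n) - 1) \<partial>Q)) at_top"
proof -
  interpret poisson_boolean_model M Z Q \<alpha>
    by (intro poisson_boolean_model.intro dim alpha Q_prob Q_sets poisson moment)
  show ?thesis
    using log_decay[of "axis k 1"] by (simp add: excess_moment_0)
qed

end
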